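(* d-separation and $\ast$-separation induce the same Markov equivalence classes of directed acyclic graphs. That is, for every positive integer $n$ and all directed acyclic graphs $G$ and $H$ with vertex set $[n]$, one has $G \sim_d H$ if and only if $G \sim_\ast H$.
   Context: Let $[n]=\{1,\dots,n\}$ and let $G$ be a directed acyclic graph (DAG) with vertex set $[n]$. A path in $G$ is a sequence of vertices $i_0, i_1, \ldots, i_k$ such that for each $\ell = 0,\ldots,k-1$ either $i_\ell \to i_{\ell+1}$ or $i_{\ell+1}\to i_\ell$ is an edge of $G$. It is a directed path from $i_0$ to $i_k$ if $i_\ell \to i_{\ell+1}$ is an edge for all $\ell$. If there is a directed path from $i$ to $j$, then $i$ is an ancestor of $j$; $\mathrm{an}(K)$ denotes the set of all ancestors of nodes in $K$. A collider on a path is a vertex $i_\ell$ of the path such that $i_{\ell-1} \rightarrow i_\ell \leftarrow i_{\ell+1}$. d-separation: Let $i \neq j$ and $K \subseteq [n]\setminus\{i,j\}$. A path $\pi$ from $i$ to $j$ is d-connecting given $K$ if all colliders on $\pi$ are in $K \cup \mathrm{an}(K)$ and no non-collider on $\pi$ is in $K$. Vertices $i,j$ are d-connected given $K$ if there is such a path. For pairwise disjoint $I,J,K \subseteq [n]$ with $I$ and $J$ nonempty, $K$ d-separates $I$ and $J$ in $G$, written $I \perp_d J \mid K$, if no $i\in I$ and $j \in J$ are d-connected given $K$. $\ast$-separation: A path $\pi$ between $i$ and $j$ is $\ast$-connecting given $K \subseteq [n]\setminus\{i,j\}$ if and only if $\pi$ is d-connecting given $K$ and $\pi$ contains at most one collider.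 Vertices $i,j$ are $\ast$-connected given $K$ if there is a $\ast$-connecting path between them. For pairwise disjoint $I,J,K\subseteq[n]$ with $I$ and $J$ nonempty, $K$ $\ast$-separates $I$ and $J$ in $G$, written $I \perp_\ast J \mid K$, if no $i\in I$ and $j\in J$ are $\ast$-connected given $K$. Markov equivalence: Two DAGs $G$ and $H$ on $[n]$ are Markov equivalent under a separation criterion $\perp$ if they yield the same set of statements $I \perp J \mid K$, for $I,J,K\subseteq [n]$ pairwise disjoint with $I,J$ nonempty. We write $G\sim_d H$ for Markov equivalence under d-separation and $G \sim_\ast H$ for Markov equivalence under $\ast$-separation. *)

theory Defs
  imports Main
begin

text \<open>
  A directed graph with vertex set \<open>[n] = {1..n}\<close> is given by \<open>n\<close> and its edge set \<open>E\<close>, where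
  \<open>(i, j) \<in> E\<close> means \<open>i \<rightarrow> j\<close>.
\<close>

definition dag :: "nat \<Rightarrow> (nat \<times> nat) set \<Rightarrow> bool" where
  "dag n E \<longleftrightarrow> E \<subseteq> {1..n} \<times> {1..n} \<and> acyclic E"

text \<open>
  The sequence \<open>i\<^sub>0, \<dots>, i\<^sub>k\<close> is the nonempty list \<open>p\<close> with \<open>p ! l = i\<^sub>l\<close>; vertices may repeat.
\<close>

definition graph_path :: "nat \<Rightarrow> (nat \<times> nat) set \<Rightarrow> nat list \<Rightarrow> bool" where
  "graph_path n E p \<longleftrightarrow> p \<noteq> [] \<and> set p \<subseteq> {1..n} \<and>
     (\<forall>l. Suc l < length p \<longrightarrow> (p ! l, p ! Suc l) \<in> E \<or> (p ! Suc l, p ! l) \<in> E)"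

definition path_between :: "nat \<Rightarrow> (nat \<times> nat) set \<Rightarrow> nat \<Rightarrow> nat \<Rightarrow> nat list \<Rightarrow> bool" where
  "path_between n E i j p \<longleftrightarrow> graph_path n E p \<and> hd p = i \<and> last p = j"

definition directed_path :: "nat \<Rightarrow> (nat \<times> nat) set \<Rightarrow> nat \<Rightarrow> nat \<Rightarrow> nat list \<Rightarrow> bool" where
  "directed_path n E i j p \<longleftrightarrow> path_between n E i j p \<and>
     (\<forall>l. Suc l < length p \<longrightarrow> (p ! l, p ! Suc l) \<in> E)"

definition ancestors :: "nat \<Rightarrow> (nat \<times> nat) set \<Rightarrow> nat set \<Rightarrow> nat set" where
  "ancestors n E K = {i. \<exists>j\<in>K. \<exists>p. directed_path n E i j p}"

text \<open>
  As a vertex may occur several times on a path, being a collider is a property of the position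
  \<open>l\<close> and not of the vertex \<open>p ! l\<close>. The two end positions are never colliders.
\<close>

definition collider_at :: "(nat \<times> nat) set \<Rightarrow> nat list \<Rightarrow> nat \<Rightarrow> bool" where
  "collider_at E p l \<longleftrightarrow> 0 < l \<and> Suc l < length p \<and>
     (p ! (l - 1), p ! l) \<in> E \<and> (p ! Suc l, p ! l) \<in> E"

definition d_connecting :: "nat \<Rightarrow> (nat \<times> nat) set \<Rightarrow> nat set \<Rightarrow> nat list \<Rightarrow> bool" where
  "d_connecting n E K p \<longleftrightarrow>
     (\<forall>l < length p. collider_at E p l \<longrightarrow> p ! l \<in> K \<union> ancestors n E K) \<and>
     (\<forall>l < length p. \<not> collider_at E p l \<longrightarrow> p ! l \<notin> K)"

definition star_connecting :: "nat \<Rightarrow> (nat \<times> nat) set \<Rightarrow> nat set \<Rightarrow> nat list \<Rightarrow> bool" where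
  "star_connecting n E K p \<longleftrightarrow> d_connecting n E K p \<and> card {l. collider_at E p l} \<le> 1"

definition d_connected :: "nat \<Rightarrow> (nat \<times> nat) set \<Rightarrow> nat set \<Rightarrow> nat \<Rightarrow> nat \<Rightarrow> bool" where
  "d_connected n E K i j \<longleftrightarrow> (\<exists>p. path_between n E i j p \<and> d_connecting n E K p)"

definition star_connected :: "nat \<Rightarrow> (nat \<times> nat) set \<Rightarrow> nat set \<Rightarrow> nat \<Rightarrow> nat \<Rightarrow> bool" where
  "star_connected n E K i j \<longleftrightarrow> (\<exists>p. path_between n E i j p \<and> star_connecting n E K p)"

text \<open>
  \<open>d_sep n E I J K\<close> is \<open>I \<bottom>\<^sub>d J | K\<close>, and \<open>star_sep n E I J K\<close> is \<open>I \<bottom>\<^sub>* J | K\<close>. Both are only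
  used for \<open>(I, J, K) \<in> ci_triples n\<close>; this also ensures \<open>i \<noteq> j\<close> and \<open>K \<subseteq> [n] - {i, j}\<close> for all
  \<open>i \<in> I\<close> and \<open>j \<in> J\<close>.
\<close>

definition ci_triples :: "nat \<Rightarrow> (nat set \<times> nat set \<times> nat set) set" where
  "ci_triples n = {(I, J, K). I \<subseteq> {1..n} \<and> J \<subseteq> {1..n} \<and> K \<subseteq> {1..n} \<and>
     I \<noteq> {} \<and> J \<noteq> {} \<and> I \<inter> J = {} \<and> I \<inter> K = {} \<and> J \<inter> K = {}}"

type_synonym separation_criterion =
  "nat \<Rightarrow> (nat \<times> nat) set \<Rightarrow> nat set \<Rightarrow> nat set \<Rightarrow> nat set \<Rightarrow> bool"

definition d_sep :: separation_criterion where
  "d_sep n E I J K \<longleftrightarrow> \<not> (\<exists>i\<in>I. \<exists>j\<in>J. d_connected n E K i j)"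

definition star_sep :: separation_criterion where
  "star_sep n E I J K \<longleftrightarrow> \<not> (\<exists>i\<in>I. \<exists>j\<in>J. star_connected n E K i j)"

definition markov_equivalent ::
    "separation_criterion \<Rightarrow> nat \<Rightarrow> (nat \<times> nat) set \<Rightarrow> (nat \<times> nat) set \<Rightarrow> bool" where
  "markov_equivalent sep n G H \<longleftrightarrow>
     {(I, J, K). (I, J, K) \<in> ci_triples n \<and> sep n G I J K} =
     {(I, J, K). (I, J, K) \<in> ci_triples n \<and> sep n H I J K}"

end

theory Submission
  imports Defs
begin

text \<open>
  Both equivalences amount to having the same skeleton and the same unshielded colliders.

  Among the connecting walks with at most a given number of colliders take a shortest one, and
  among those one whose colliders are closest to \<open>K\<close>. Shortcuts never increase the number of
  colliders, so minimality forces every collider to be unshielded, and the walk has the same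
  colliders in every graph with the same structure; likewise shortest descending paths from the
  colliders to \<open>K\<close> keep their orientation. As the number of colliders is preserved, this treats both
  criteria at once.

  Conversely, if \<open>j\<close> is not an ancestor of \<open>i\<close> and not adjacent to \<open>i\<close>, the parents of \<open>j\<close> separate the
  two, and one edge, or two edges with at most one collider, are all that is needed to read off
  the skeleton and the unshielded colliders.
\<close>

section \<open>Structure of a graph and recursive walks\<close>

abbreviation adj :: "('a \<times> 'a) set \<Rightarrow> 'a \<Rightarrow> 'a \<Rightarrow> bool" where
  "adj E v w \<equiv> (v, w) \<in> E \<or> (w, v) \<in> E"

text \<open>The condition \<open>u \<noteq> w\<close> excludes an edge run back and forth, which
  walks with repeated vertices allow.\<close>

definition v_structure :: "('a \<times> 'a) set \<Rightarrow> 'a \<Rightarrow> 'a \<Rightarrow> 'a \<Rightarrow> bool" where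
  "v_structure E u v w \<longleftrightarrow> (u, v) \<in> E \<and> (w, v) \<in> E \<and> u \<noteq> w \<and> \<not> adj E u w"

definition same_structure :: "('a \<times> 'a) set \<Rightarrow> ('a \<times> 'a) set \<Rightarrow> bool" where
  "same_structure G H \<longleftrightarrow> (\<forall>u v. adj G u v \<longleftrightarrow> adj H u v) \<and>
     (\<forall>u v w. v_structure G u v w \<longleftrightarrow> v_structure H u v w)"

definition anc :: "('a \<times> 'a) set \<Rightarrow> 'a set \<Rightarrow> 'a set" where
  "anc E K = {v. \<exists>k\<in>K. (v, k) \<in> E\<^sup>*}"

text \<open>Directed distance to \<open>K\<close>. It is meaningful only on \<open>anc E K\<close>,
  where \<open>LEAST\<close> has a witness; the colliders of an open walk lie there.\<close>

definition depth :: "('a \<times> 'a) set \<Rightarrow> 'a set \<Rightarrow> 'a \<Rightarrow> nat" where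
  "depth E K v = (LEAST m. \<exists>k\<in>K. (v, k) \<in> E ^^ m)"

text \<open>
  A walk is read from left to right: \<open>v\<close> is its current vertex, the list contains the vertices
  still to come, and the flag \<open>s\<close> tells whether \<open>v\<close> was entered through an arrowhead. It is
  \<open>False\<close> at the start, which makes the start a non-collider.
\<close>

fun open_walk :: "('a \<times> 'a) set \<Rightarrow> 'a set \<Rightarrow> bool \<Rightarrow> 'a \<Rightarrow> 'a list \<Rightarrow> bool" where
  "open_walk E K s v [] \<longleftrightarrow> v \<notin> K"
| "open_walk E K s v (w # q) \<longleftrightarrow> adj E v w \<and>
     (if s \<and> (w, v) \<in> E then v \<in> anc E K else v \<notin> K) \<and> open_walk E K ((v, w) \<in> E) w q"

fun colliders :: "('a \<times> 'a) set \<Rightarrow> bool \<Rightarrow> 'a \<Rightarrow> 'a list \<Rightarrow> nat" where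
  "colliders E s v [] = 0"
| "colliders E s v (w # q) = (if s \<and> (w, v) \<in> E then 1 else 0) + colliders E ((v, w) \<in> E) w q"

fun collider_depth :: "('a \<times> 'a) set \<Rightarrow> 'a set \<Rightarrow> bool \<Rightarrow> 'a \<Rightarrow> 'a list \<Rightarrow> nat" where
  "collider_depth E K s v [] = 0"
| "collider_depth E K s v (w # q) =
     (if s \<and> (w, v) \<in> E then depth E K v else 0) + collider_depth E K ((v, w) \<in> E) w q"

text \<open>Minimality is lexicographic: length first, total depth of the colliders as a tie-break.
  The number of colliders is a budget for the competitors, not a quantity to be minimised.\<close>

definition minimal_walk :: "('a \<times> 'a) set \<Rightarrow> 'a set \<Rightarrow> bool \<Rightarrow> 'a \<Rightarrow> 'a list \<Rightarrow> bool" where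
  "minimal_walk E K s v q \<longleftrightarrow> open_walk E K s v q \<and>
     (\<forall>q'. open_walk E K s v q' \<and> last (v # q') = last (v # q) \<and>
        colliders E s v q' \<le> colliders E s v q \<longrightarrow>
        length q \<le> length q' \<and>
        (length q' = length q \<longrightarrow> collider_depth E K s v q \<le> collider_depth E K s v q'))"

text \<open>The two instances are \<open>\<lambda>_. True\<close> for d-connection and
  \<open>\<lambda>c. c \<le> 1\<close> for star-connection.\<close>

definition connected_within ::
    "('a \<times> 'a) set \<Rightarrow> 'a set \<Rightarrow> (nat \<Rightarrow> bool) \<Rightarrow> 'a \<Rightarrow> 'a \<Rightarrow> bool" where
  "connected_within E K B i j \<longleftrightarrow>
     (\<exists>q. open_walk E K False i q \<and> last (i # q) = j \<and> B (colliders E False i q))"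

section \<open>Minimal walks\<close>

lemma anc_base: "v \<in> K \<Longrightarrow> v \<in> anc E K"
  by (auto simp: anc_def)

lemma anc_step: "(v, w) \<in> E \<Longrightarrow> w \<in> anc E K \<Longrightarrow> v \<in> anc E K"
  by (auto simp: anc_def intro: converse_rtrancl_into_rtrancl)

lemma acyclic_no_2_cycle: "acyclic E \<Longrightarrow> (u, v) \<in> E \<Longrightarrow> (v, u) \<notin> E"
  by (meson acyclic_def r_into_trancl trancl_into_trancl)

lemma acyclic_no_3_cycle: "acyclic E \<Longrightarrow> (u, v) \<in> E \<Longrightarrow> (v, w) \<in> E \<Longrightarrow> (w, u) \<notin> E"
  by (meson acyclic_def r_into_trancl trancl_into_trancl)

lemma acyclic_no_loop: "acyclic E \<Longrightarrow> (u, u) \<notin> E"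
  by (auto simp: acyclic_def)

text \<open>The flag affects only the status of the first vertex. A vertex of \<open>anc E K\<close>
  outside \<open>K\<close> may be a collider or a non-collider, and only raising the flag can create
  a collider.\<close>

lemma open_walk_change_flag:
  assumes "open_walk E K s v q" "v \<notin> K" "s' \<Longrightarrow> v \<in> anc E K"
  shows "open_walk E K s' v q"
    and "colliders E s' v q \<le> colliders E s v q + (if s' \<and> \<not> s then 1 else 0)"
  using assms by (cases q; auto)+

text \<open>Well-founded descent: a non-minimal walk has a lexicographically smaller competitor, and
  the bounds on colliders compose.\<close>

lemma minimal_walk_exists:
  assumes "open_walk E K s v q"
  shows "\<exists>q'. minimal_walk E K s v q' \<and> last (v # q') = last (v # q) \<and>
    colliders E s v q' \<le> colliders E s v q"
  using assms
proof (induction q rule: wf_induct_rule[OF wf_measures[of "[length, collider_depth E K s v]"]])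
  case (1 q)
  show ?case
  proof (cases "minimal_walk E K s v q")
    case False
    then obtain q' where q': "open_walk E K s v q'" "last (v # q') = last (v # q)"
      "colliders E s v q' \<le> colliders E s v q"
      "(q', q) \<in> measures [length, collider_depth E K s v]"
      using 1(2) unfolding minimal_walk_def by fastforce
    then show ?thesis using 1(1)[OF q'(4,1)] by (metis le_trans)
  qed auto
qed

lemma minimal_walk_openD: "minimal_walk E K s v q \<Longrightarrow> open_walk E K s v q"
  by (simp add: minimal_walk_def)

lemma minimal_walk_length:
  assumes "minimal_walk E K s v q" "open_walk E K s v q'" "last (v # q') = last (v # q)"
    "colliders E s v q' \<le> colliders E s v q"
  shows "length q \<le> length q'"
  using assms by (simp add: minimal_walk_def)

lemma minimal_walk_depth:
  assumes "minimal_walk E K s v q" "open_walk E K s v q'" "last (v # q') = last (v # q)"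
    "colliders E s v q' \<le> colliders E s v q" "length q' = length q"
  shows "collider_depth E K s v q \<le> collider_depth E K s v q'"
  using assms by (simp add: minimal_walk_def)

text \<open>A better tail would give a better walk, since prepending \<open>v\<close> contributes
  the same collider and the same depth to both.\<close>

lemma minimal_walk_tl:
  assumes min: "minimal_walk E K s v (w # q)"
  shows "minimal_walk E K ((v, w) \<in> E) w q"
  unfolding minimal_walk_def
proof (intro conjI allI impI)
  show "open_walk E K ((v, w) \<in> E) w q" using minimal_walk_openD[OF min] by simp
  fix q' assume a: "open_walk E K ((v, w) \<in> E) w q' \<and> last (w # q') = last (w # q) \<and>
    colliders E ((v, w) \<in> E) w q' \<le> colliders E ((v, w) \<in> E) w q"
  then have o: "open_walk E K s v (w # q')" using minimal_walk_openD[OF min] by simp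
  have l: "last (v # w # q') = last (v # w # q)"
    and c: "colliders E s v (w # q') \<le> colliders E s v (w # q)" using a by simp_all
  show "length q \<le> length q'" using minimal_walk_length[OF min o l c] by simp
  show "collider_depth E K ((v, w) \<in> E) w q \<le> collider_depth E K ((v, w) \<in> E) w q'"
    if "length q' = length q"
    using minimal_walk_depth[OF min o l c] that by simp
qed

lemma minimal_walk_no_shortcut:
  assumes "minimal_walk E K s v q" "open_walk E K s v q'" "last (v # q') = last (v # q)"
    "length q' < length q"
  shows "colliders E s v q < colliders E s v q'"
  using minimal_walk_length[OF assms(1-3)] assms(4) by linarith

section \<open>Colliders, forks and chains in a minimal walk\<close>

text \<open>If \<open>v\<close> and \<open>y\<close> were equal or adjacent, \<open>w\<close> could
  be bypassed. Both are non-colliders outside \<open>K\<close> and, as parents of \<open>w\<close>,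
  lie in \<open>anc E K\<close>, so either may become a collider. At most one does, and the loss of
  the collider \<open>w\<close> pays for it.\<close>

lemma minimal_walk_collider_unshielded:
  assumes ac: "acyclic E" and min: "minimal_walk E K s v (w # y # q)"
    and vw: "(v, w) \<in> E" and yw: "(y, w) \<in> E"
  shows "v_structure E v w y"
proof -
  note o = minimal_walk_openD[OF min]
  have no: "(w, v) \<notin> E" "(w, y) \<notin> E" using acyclic_no_2_cycle[OF ac] vw yw by auto
  have wA: "w \<in> anc E K" and vK: "v \<notin> K" and oy: "open_walk E K False y q"
    using o vw yw no by auto
  have yK: "y \<notin> K" using oy by (cases q) auto
  have vA: "v \<in> anc E K" and yA: "y \<in> anc E K" using wA vw yw anc_step by metis+
  have "v \<noteq> y"
  proof
    assume "v = y"
    then have "open_walk E K s v q" "colliders E s v q \<le> colliders E False v q + 1"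
      using open_walk_change_flag[of E K False v q s] oy vA yK by (auto split: if_splits)
    moreover have "colliders E s v (w # y # q) = colliders E False y q + 1"
      using vw yw no by simp
    ultimately show False
      using minimal_walk_no_shortcut[OF min, of q] \<open>v = y\<close> by auto
  qed
  moreover have "(v, y) \<notin> E"
  proof
    assume vy: "(v, y) \<in> E"
    then have nyv: "(y, v) \<notin> E" using acyclic_no_2_cycle[OF ac] by auto
    have "open_walk E K True y q" "colliders E True y q \<le> colliders E False y q + 1"
      using open_walk_change_flag[OF oy yK, of True] yA by auto
    then show False
      using minimal_walk_no_shortcut[OF min, of "y # q"] vy nyv vK vw yw no by auto
  qed
  moreover have "(y, v) \<notin> E"
  proof
    assume yv: "(y, v) \<in> E"
    then have nvy: "(v, y) \<notin> E" using acyclic_no_2_cycle[OF ac] by auto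
    show False
      using minimal_walk_no_shortcut[OF min, of "y # q"] yv nvy vK vA vw yw no oy
      by (cases s) auto
  qed
  ultimately show ?thesis using vw yw by (auto simp: v_structure_def)
qed

text \<open>Bypassing \<open>w\<close> along the edge between \<open>v\<close> and \<open>y\<close>
  keeps the arrowhead at the head of that edge and removes the one at its tail. The shortcut can
  fail only if the tail was a collider, which may lie in \<open>K\<close> and then must not become a
  non-collider.\<close>

lemma minimal_walk_fork:
  assumes ac: "acyclic E" and min: "minimal_walk E K s v (w # y # q)"
    and wv: "(w, v) \<in> E" and wy: "(w, y) \<in> E" and sh: "v = y \<or> adj E v y"
  shows "(s \<and> (v, y) \<in> E) \<or>
    (\<exists>x q'. q = x # q' \<and> (x, y) \<in> E \<and> (y, v) \<in> E)"
proof -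
  note o = minimal_walk_openD[OF min]
  have no: "(v, w) \<notin> E" "(y, w) \<notin> E" using acyclic_no_2_cycle[OF ac] wv wy by auto
  have wK: "w \<notin> K" and v: "if s then v \<in> anc E K else v \<notin> K" and oy: "open_walk E K True y q"
    using o wv wy no by auto
  have c: "colliders E s v (w # y # q) = (if s then 1 else 0) + colliders E True y q"
    using wv wy no by simp
  have "v \<noteq> y"
  proof
    assume vy: "v = y"
    \<comment> \<open>Two steps are dropped and the flag at \<open>v\<close> becomes
      \<open>s\<close> instead of \<open>True\<close>; if \<open>s\<close> is false,
      \<open>v\<close> is outside \<open>K\<close>.\<close>
    have "open_walk E K s v q \<and> colliders E s v q \<le> colliders E True y q"
      using vy oy v open_walk_change_flag[of E K True v q False] by (cases s) auto
    then show False
      using minimal_walk_no_shortcut[OF min, of q] vy c by auto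
  qed
  with sh consider "(v, y) \<in> E" | "(y, v) \<in> E" by blast
  then show ?thesis
  proof cases
    case 1
    have s
    proof (rule ccontr)
      assume "\<not> s"
      then show False
        using minimal_walk_no_shortcut[OF min, of "y # q"] 1 v oy c by auto
    qed
    with 1 show ?thesis by simp
  next
    case 2
    then have nvy: "(v, y) \<notin> E" using acyclic_no_2_cycle[OF ac] by auto
    have "y \<in> K"
    proof (rule ccontr)
      assume "y \<notin> K"
      then have "open_walk E K False y q" "colliders E False y q \<le> colliders E True y q"
        using open_walk_change_flag[OF oy, of False] by auto
      then show False
        using minimal_walk_no_shortcut[OF min, of "y # q"] 2 nvy v c by (auto split: if_splits)
    qed
    then show ?thesis using oy 2 by (cases q) (auto split: if_splits)
  qed
qed

text \<open>By acyclicity an edge between \<open>v\<close> and \<open>y\<close> points along the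
  chain, so the shortcut would leave the status of both ends unchanged.\<close>

lemma minimal_walk_chain:
  assumes ac: "acyclic E" and min: "minimal_walk E K s v (w # y # q)"
    and chain: "(v, w) \<in> E \<and> (w, y) \<in> E \<or> (y, w) \<in> E \<and> (w, v) \<in> E"
  shows "v \<noteq> y \<and> \<not> adj E v y"
proof -
  note o = minimal_walk_openD[OF min]
  show ?thesis using chain
  proof
    assume e: "(v, w) \<in> E \<and> (w, y) \<in> E"
    then have no: "(w, v) \<notin> E" "(y, w) \<notin> E" "v \<noteq> y" "(y, v) \<notin> E"
      using acyclic_no_2_cycle[OF ac] acyclic_no_3_cycle[OF ac] by blast+
    moreover have "(v, y) \<notin> E"
      using minimal_walk_no_shortcut[OF min, of "y # q"] o e no by auto
    ultimately show ?thesis by simp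
  next
    assume e: "(y, w) \<in> E \<and> (w, v) \<in> E"
    then have no: "(v, w) \<notin> E" "(w, y) \<notin> E" "v \<noteq> y" "(v, y) \<notin> E"
      using acyclic_no_2_cycle[OF ac] acyclic_no_3_cycle[OF ac] by blast+
    moreover have "(y, v) \<notin> E"
      using minimal_walk_no_shortcut[OF min, of "y # q"] o e no by (auto split: if_splits)
    ultimately show ?thesis by simp
  qed
qed

section \<open>Transfer between graphs with the same structure\<close>

lemma depth_le: "k \<in> K \<Longrightarrow> (v, k) \<in> E ^^ m \<Longrightarrow> depth E K v \<le> m"
  unfolding depth_def by (rule Least_le) blast

lemma depth_witness:
  assumes "v \<in> anc E K"
  shows "\<exists>k\<in>K. (v, k) \<in> E ^^ depth E K v"
  unfolding depth_def
  by (rule LeastI_ex) (use assms in \<open>auto simp: anc_def dest!: rtrancl_imp_relpow\<close>)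

lemma depth_edge_le:
  assumes "(v, w) \<in> E" "w \<in> anc E K"
  shows "depth E K v \<le> Suc (depth E K w)"
  using depth_witness[OF assms(2)] assms(1) by (metis depth_le relpow_Suc_I2)

lemma anc_decrease_depth:
  assumes "v \<in> anc E K" "v \<notin> K"
  shows "\<exists>w. (v, w) \<in> E \<and> w \<in> anc E K \<and> depth E K v = Suc (depth E K w)"
proof -
  obtain k where k: "k \<in> K" "(v, k) \<in> E ^^ depth E K v" using depth_witness[OF assms(1)] by blast
  with assms(2) obtain m where m: "depth E K v = Suc m" by (cases "depth E K v") auto
  then obtain w where w: "(v, w) \<in> E" "(w, k) \<in> E ^^ m" using k(2) by (metis relpow_Suc_D2)
  then have "w \<in> anc E K" "depth E K w \<le> m"
    using k(1) depth_le by (auto simp: anc_def dest: relpow_imp_rtrancl)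
  with w(1) m depth_edge_le show ?thesis by (metis Suc_le_mono le_antisym)
qed

lemma same_structure_sym: "same_structure G H \<Longrightarrow> same_structure H G"
  by (simp add: same_structure_def)

text \<open>Reversing the second edge would create an unshielded collider in \<open>H\<close> that
  \<open>G\<close> does not have.\<close>

lemma same_structure_chain:
  assumes "same_structure G H" "acyclic G" "(u, v) \<in> G" "(v, w) \<in> G" "\<not> adj G u w" "(u, v) \<in> H"
  shows "(v, w) \<in> H"
proof (rule ccontr)
  assume "(v, w) \<notin> H"
  then have "(w, v) \<in> H" "\<not> adj H u w" using assms(1,4,5) by (auto simp: same_structure_def)
  moreover have "u \<noteq> w" "(w, v) \<notin> G" using acyclic_no_2_cycle[OF assms(2)] assms(3,4) by blast+
  ultimately have "v_structure H u v w" "\<not> v_structure G u v w"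
    using assms(6) by (auto simp: v_structure_def)
  then show False using assms(1) by (simp add: same_structure_def)
qed

text \<open>On a shortest descending path to \<open>K\<close>, vertices two steps apart are not
  adjacent: a forward edge would shorten the path, a backward one would close a cycle. Hence the
  orientation of one edge in \<open>H\<close> propagates to all later ones.\<close>

lemma anc_transfer_geodesic:
  assumes same: "same_structure G H" and ac: "acyclic G"
  shows "(v, w) \<in> G \<Longrightarrow> (v, w) \<in> H \<Longrightarrow> w \<in> anc G K \<Longrightarrow> depth G K v = Suc (depth G K w) \<Longrightarrow>
    w \<in> anc H K"
proof (induction "depth G K w" arbitrary: v w rule: less_induct)
  case less
  show ?case
  proof (cases "w \<in> K")
    case True then show ?thesis by (rule anc_base)
  next
    case False
    then obtain x where x: "(w, x) \<in> G" "x \<in> anc G K" "depth G K w = Suc (depth G K x)"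
      using anc_decrease_depth less.prems(3) by metis
    have "(v, x) \<notin> G" using depth_edge_le[of v x G K] x less.prems(4) by auto
    moreover have "(x, v) \<notin> G" using acyclic_no_3_cycle[OF ac] less.prems(1) x(1) by blast
    ultimately have "(w, x) \<in> H"
      using same_structure_chain[OF same ac less.prems(1) x(1)] less.prems(2) by blast
    then show ?thesis using less.hyps[of x w] x anc_step by fastforce
  qed
qed

text \<open>The unshielded collider fixes \<open>v \<rightarrow> w \<leftarrow> y\<close> in
  \<open>H\<close>. The first edge \<open>w \<rightarrow> d\<close> of a shortest path to
  \<open>K\<close> forms an unshielded chain with one of these two edges, which orients it in
  \<open>H\<close>; the rest of the path follows.\<close>

lemma minimal_walk_collider_anc:
  assumes same: "same_structure G H" and ac: "acyclic G"
    and min: "minimal_walk G K s v (w # y # q)"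
    and vw: "(v, w) \<in> G" and yw: "(y, w) \<in> G"
  shows "w \<in> anc H K"
proof (cases "w \<in> K")
  case True then show ?thesis by (rule anc_base)
next
  case False
  note o = minimal_walk_openD[OF min]
  have no: "(w, v) \<notin> G" "(w, y) \<notin> G" using acyclic_no_2_cycle[OF ac] vw yw by auto
  have wA: "w \<in> anc G K" using o vw yw by auto
  obtain d where d: "(w, d) \<in> G" "d \<in> anc G K" "depth G K w = Suc (depth G K d)"
    using anc_decrease_depth wA False by metis
  have vH: "v_structure H v w y"
    using minimal_walk_collider_unshielded[OF ac min vw yw] same by (simp add: same_structure_def)
  have nd: "(d, v) \<notin> G" "(d, y) \<notin> G" using acyclic_no_3_cycle[OF ac] vw yw d(1) by blast+
  have "\<not> ((v, d) \<in> G \<and> (y, d) \<in> G)"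
  proof
    assume vd: "(v, d) \<in> G \<and> (y, d) \<in> G"
    \<comment> \<open>The tie-break enters here: putting \<open>d\<close> in place of
      \<open>w\<close> keeps length and number of colliders but lowers the depth.\<close>
    have "open_walk G K s v (d # y # q)" using o vw yw no nd vd d(2) by auto
    from minimal_walk_depth[OF min this] show False using vw yw vd no nd d(3) by auto
  qed
  then consider "\<not> adj G v d" | "\<not> adj G y d" using nd by auto
  then have "(w, d) \<in> H"
  proof cases
    case 1
    then show ?thesis
      using same_structure_chain[OF same ac vw d(1)] vH by (simp add: v_structure_def)
  next
    case 2
    then show ?thesis
      using same_structure_chain[OF same ac yw d(1)] vH by (simp add: v_structure_def)
  qed
  then show ?thesis
    using anc_transfer_geodesic[OF same ac d(1) _ d(2,3)] anc_step by metis
qed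

text \<open>
  A shielded fork \<open>v \<leftarrow> w \<rightarrow> y\<close> can survive in a minimal walk, but only next to a collider in \<open>K\<close>;
  that collider is unshielded, hence present in \<open>H\<close>, and fixes one of the two edges of the fork.
  When the collider is \<open>v\<close>, this information is contained in the hypothesis \<open>first\<close> of
  \<open>minimal_walk_transfer\<close>.
\<close>

lemma minimal_walk_same_collider:
  assumes same: "same_structure G H" and acG: "acyclic G" and acH: "acyclic H"
    and min: "minimal_walk G K s v (w # y # q)"
    and first: "s \<and> (w, v) \<in> G \<Longrightarrow> (w, v) \<in> H"
  shows "(v, w) \<in> H \<and> (y, w) \<in> H \<longleftrightarrow> (v, w) \<in> G \<and> (y, w) \<in> G"
proof (cases "(v, w) \<in> G \<and> (y, w) \<in> G")
  case True
  then have "v_structure H v w y"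
    using minimal_walk_collider_unshielded[OF acG min] same by (simp add: same_structure_def)
  with True show ?thesis by (simp add: v_structure_def)
next
  case False
  have e: "adj G v w" "adj G w y" using minimal_walk_openD[OF min] by auto
  have "\<not> ((v, w) \<in> H \<and> (y, w) \<in> H)"
  proof (cases "v = y \<or> adj G v y")
    case True
    then have fork: "(w, v) \<in> G" "(w, y) \<in> G"
      using minimal_walk_chain[OF acG min] e False by blast+
    from minimal_walk_fork[OF acG min fork True] show ?thesis
    proof (elim disjE exE conjE)
      assume s
      then show ?thesis using first fork acyclic_no_2_cycle[OF acH] by blast
    next
      fix x q' assume x: "q = x # q'" "(x, y) \<in> G"
      have "minimal_walk G K ((v, w) \<in> G) w (y # x # q')" using minimal_walk_tl min x(1) by metis
      then have "v_structure H w y x"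
        using minimal_walk_collider_unshielded[OF acG _ fork(2) x(2)] same
        by (auto simp: same_structure_def)
      then show ?thesis using acyclic_no_2_cycle[OF acH] by (auto simp: v_structure_def)
    qed
  next
    case unshielded: False
    show ?thesis
    proof
      assume "(v, w) \<in> H \<and> (y, w) \<in> H"
      then have "v_structure H v w y"
        using unshielded same by (auto simp: v_structure_def same_structure_def)
      then have "v_structure G v w y" using same by (simp add: same_structure_def)
      then show False using False by (simp add: v_structure_def)
    qed
  qed
  with False show ?thesis by blast
qed

text \<open>The flags \<open>s\<close> in \<open>G\<close> and \<open>t\<close> in \<open>H\<close>
  may differ, since edges of the walk can be reversed in \<open>H\<close>. The induction therefore
  carries only agreement on whether \<open>v\<close> is a collider.\<close>

lemma minimal_walk_transfer:
  assumes same: "same_structure G H" and acG: "acyclic G" and acH: "acyclic H"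
  shows "minimal_walk G K s v q \<Longrightarrow>
    (\<And>w q'. q = w # q' \<Longrightarrow> (t \<and> (w, v) \<in> H \<longleftrightarrow> s \<and> (w, v) \<in> G) \<and>
       (s \<and> (w, v) \<in> G \<longrightarrow> v \<in> anc H K)) \<Longrightarrow>
    open_walk H K t v q \<and> colliders H t v q = colliders G s v q"
proof (induction q arbitrary: s t v)
  case Nil
  then show ?case by (auto dest: minimal_walk_openD)
next
  case (Cons w q)
  note min = Cons.prems(1) and first = Cons.prems(2)[OF refl]
  have "open_walk H K ((v, w) \<in> H) w q \<and>
    colliders H ((v, w) \<in> H) w q = colliders G ((v, w) \<in> G) w q"
  proof (rule Cons.IH[OF minimal_walk_tl[OF min]])
    fix y q' assume q: "q = y # q'"
    show "((v, w) \<in> H \<and> (y, w) \<in> H \<longleftrightarrow> (v, w) \<in> G \<and> (y, w) \<in> G) \<and>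
      ((v, w) \<in> G \<and> (y, w) \<in> G \<longrightarrow> w \<in> anc H K)"
      using minimal_walk_same_collider[OF same acG acH min[unfolded q]]
        minimal_walk_collider_anc[OF same acG min[unfolded q]] first by blast
  qed
  moreover have "adj H v w" using minimal_walk_openD[OF min] same by (simp add: same_structure_def)
  moreover have "if s \<and> (w, v) \<in> G then v \<in> anc G K else v \<notin> K"
    using minimal_walk_openD[OF min] by simp
  ultimately show ?case using first by (auto split: if_splits)
qed

lemma connected_within_transfer:
  assumes "same_structure G H" "acyclic G" "acyclic H"
    and B: "antimono B"
    and "connected_within G K B i j"
  shows "connected_within H K B i j"
proof -
  obtain q where q: "open_walk G K False i q" "last (i # q) = j" "B (colliders G False i q)"
    using assms(5) by (auto simp: connected_within_def)
  from minimal_walk_exists[OF q(1)] obtain r where r: "minimal_walk G K False i r"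
    "last (i # r) = j" "colliders G False i r \<le> colliders G False i q"
    using q(2) by metis
  \<comment> \<open>Both flags are \<open>False\<close> at the start, so the two graphs agree there
    trivially.\<close>
  have "open_walk H K False i r \<and> colliders H False i r = colliders G False i r"
    by (rule minimal_walk_transfer[OF assms(1-3) r(1)]) simp
  moreover have "B (colliders G False i r)" using antimonoD[OF B r(3)] q(3) by simp
  ultimately show ?thesis using r(2) by (auto simp only: connected_within_def)
qed

section \<open>Recovering the structure\<close>

text \<open>A collider at a strict descendant of \<open>j\<close> would be an ancestor of a parent
  of \<open>j\<close> and close a cycle. So the walk can only keep descending.\<close>

lemma open_walk_parents_descendant:
  assumes ac: "acyclic E" and K: "K = {k. (k, j) \<in> E}"
  shows "open_walk E K True v q \<Longrightarrow> (j, v) \<in> E\<^sup>+ \<Longrightarrow> (j, last (v # q)) \<in> E\<^sup>+"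
proof (induction q arbitrary: v)
  case (Cons w q)
  show ?case
  proof (cases "(w, v) \<in> E")
    case True
    then have "v \<in> anc E K" using Cons.prems by auto
    then obtain k where "(v, k) \<in> E\<^sup>*" "(k, j) \<in> E" by (auto simp: anc_def K)
    then have "(v, j) \<in> E\<^sup>+" by simp
    then show ?thesis using Cons.prems(2) ac by (meson acyclic_def trancl_trans)
  next
    case False
    then have vw: "(v, w) \<in> E" "open_walk E K True w q" using Cons.prems(1) by auto
    show ?thesis using Cons.IH[OF vw(2)] vw(1) Cons.prems(2) by (simp add: trancl.intros(2))
  qed
qed simp

text \<open>Consider the first entry into the descendants of \<open>j\<close>, including
  \<open>j\<close>. It is along \<open>v \<rightarrow> w\<close> with the non-collider
  \<open>v\<close> outside \<open>K\<close>, so \<open>w \<noteq> j\<close>, and from there the walk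
  descends without reaching \<open>j\<close>.\<close>

lemma open_walk_parents_avoids:
  assumes ac: "acyclic E" and K: "K = {k. (k, j) \<in> E}"
  shows "open_walk E K s v q \<Longrightarrow> (j, v) \<notin> E\<^sup>* \<Longrightarrow> last (v # q) \<noteq> j"
proof (induction q arbitrary: s v)
  case (Cons w q)
  show ?case
  proof (cases "(j, w) \<in> E\<^sup>*")
    case False
    then show ?thesis using Cons by auto
  next
    case True
    have nwv: "(w, v) \<notin> E" using True Cons.prems(2) by (meson rtrancl.rtrancl_into_rtrancl)
    then have vw: "(v, w) \<in> E" "v \<notin> K" "open_walk E K True w q" using Cons.prems(1) by auto
    then have "w \<noteq> j" using K by auto
    then have "(j, w) \<in> E\<^sup>+" using True by (metis rtranclD)
    then have "(j, last (w # q)) \<in> E\<^sup>+" using open_walk_parents_descendant[OF ac K vw(3)] by simp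
    then show ?thesis using ac by (auto simp: acyclic_def)
  qed
qed auto

text \<open>By acyclicity one of the two vertices is not reachable from the other; it becomes the
  start \<open>a\<close>, and the parents of \<open>b\<close> separate. Leaving the order open
  avoids any appeal to symmetry of \<open>connected_within\<close>.\<close>

lemma nonadjacent_separated:
  assumes ac: "acyclic E" and "i \<noteq> j" "\<not> adj E i j" "E \<subseteq> V \<times> V"
  shows "\<exists>a b K. (a = i \<and> b = j \<or> a = j \<and> b = i) \<and> K \<subseteq> V - {a, b} \<and>
    (\<forall>B. \<not> connected_within E K B a b)"
proof -
  obtain a b where ab: "a = i \<and> b = j \<or> a = j \<and> b = i" "(b, a) \<notin> E\<^sup>*"
    using ac \<open>i \<noteq> j\<close> by (metis acyclic_impl_antisym_rtrancl antisymD)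
  let ?K = "{k. (k, b) \<in> E}"
  have "?K \<subseteq> V - {a, b}" using ab(1) assms(3,4) acyclic_no_loop[OF ac] by auto
  moreover have "\<not> connected_within E ?K B a b" for B
    unfolding connected_within_def using open_walk_parents_avoids[OF ac refl _ ab(2)] by blast
  ultimately show ?thesis using ab(1) by blast
qed

lemma connected_within_adj:
  assumes "adj E i j" "i \<notin> K" "j \<notin> K" "B 0"
  shows "connected_within E K B i j"
  unfolding connected_within_def using assms by (intro exI[of _ "[j]"]) auto

lemma connected_within_triple:
  assumes "adj E i k" "adj E k j" "i \<notin> K" "j \<notin> K" "B 0" "B 1"
    and "if (i, k) \<in> E \<and> (j, k) \<in> E then k \<in> K else k \<notin> K"
  shows "connected_within E K B i j"
  unfolding connected_within_def using assms
  by (intro exI[of _ "[k, j]"]) (auto intro: anc_base split: if_splits)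

lemma v_structure_commute: "v_structure E u v w \<longleftrightarrow> v_structure E w v u"
  by (auto simp: v_structure_def)

context
  fixes G H :: "('a \<times> 'a) set" and V :: "'a set" and B :: "nat \<Rightarrow> bool"
  assumes G: "G \<subseteq> V \<times> V" "acyclic G" and H: "H \<subseteq> V \<times> V" "acyclic H"
    and B: "B 0" "B 1"
    and eq: "\<And>i j K. i \<in> V \<Longrightarrow> j \<in> V \<Longrightarrow> i \<noteq> j \<Longrightarrow> K \<subseteq> V - {i, j} \<Longrightarrow>
      connected_within H K B i j \<Longrightarrow> connected_within G K B i j"
begin

text \<open>A set separating \<open>i\<close> and \<open>j\<close> in \<open>G\<close> cannot block
  the single edge in \<open>H\<close>.\<close>

lemma adj_recovered:
  assumes "adj H i j"
  shows "adj G i j"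
proof (rule ccontr)
  assume n: "\<not> adj G i j"
  have ij: "i \<in> V" "j \<in> V" "i \<noteq> j" using assms H acyclic_no_loop[OF H(2)] by auto
  obtain a b K where ab: "a = i \<and> b = j \<or> a = j \<and> b = i" "K \<subseteq> V - {a, b}"
    "\<And>B. \<not> connected_within G K B a b"
    using nonadjacent_separated[OF G(2) ij(3) n G(1)] by blast
  have "connected_within H K B a b"
    by (rule connected_within_adj) (use ab assms B in auto)
  then show False using eq[of a b K] ab ij by auto
qed

text \<open>A set \<open>K\<close> separating the ends in \<open>G\<close> cannot contain the
  collider \<open>k\<close>. It separates them in \<open>H\<close> too, where a non-collider
  \<open>k\<close> outside \<open>K\<close> would connect them.\<close>

lemma v_structure_recovered:
  assumes adj: "\<And>u v. adj G u v \<longleftrightarrow> adj H u v" and v: "v_structure G i k j"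
  shows "v_structure H i k j"
proof -
  have ij: "i \<noteq> j" "\<not> adj G i j" "i \<in> V" "j \<in> V" using v G(1) by (auto simp: v_structure_def)
  obtain a b K where ab: "a = i \<and> b = j \<or> a = j \<and> b = i" "K \<subseteq> V - {a, b}"
    "\<And>B. \<not> connected_within G K B a b"
    using nonadjacent_separated[OF G(2) ij(1,2) G(1)] by blast
  have vab: "v_structure G a k b" using ab(1) v v_structure_commute by metis
  then have adjs: "adj G a k" "adj G k b" by (auto simp: v_structure_def)
  have nK: "a \<notin> K" "b \<notin> K" using ab(2) by auto
  have "k \<notin> K"
    using connected_within_triple[OF adjs nK, of B] B ab(3) vab by (auto simp: v_structure_def)
  moreover have "\<not> connected_within H K B a b" using eq[of a b K] ab ij by auto
  ultimately have "(a, k) \<in> H \<and> (b, k) \<in> H"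
    using connected_within_triple[where E = H and B = B, OF _ _ nK B] adjs adj by metis
  then have "v_structure H a k b" using vab adj by (auto simp: v_structure_def)
  then show ?thesis using ab(1) v_structure_commute by metis
qed

end

lemma connected_within_iff_same_structure:
  assumes G: "G \<subseteq> V \<times> V" "acyclic G" and H: "H \<subseteq> V \<times> V" "acyclic H"
    and B: "B 1" "antimono B"
  shows "(\<forall>i\<in>V. \<forall>j\<in>V. \<forall>K \<subseteq> V - {i, j}. i \<noteq> j \<longrightarrow>
      connected_within G K B i j = connected_within H K B i j) \<longleftrightarrow> same_structure G H"
    (is "?eq \<longleftrightarrow> _")
proof
  assume ?eq
  then have eq: "connected_within H K B i j = connected_within G K B i j"
    if "i \<in> V" "j \<in> V" "i \<noteq> j" "K \<subseteq> V - {i, j}" for i j K using that by blast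
  have B0: "B 0" using antimonoD[OF B(2), of 0 1] B(1) by simp
  have adj: "adj G u v \<longleftrightarrow> adj H u v" for u v
    using adj_recovered[OF G H B0 B(1), where i = u and j = v]
      adj_recovered[OF H G B0 B(1), where i = u and j = v] eq by blast
  moreover have "v_structure G u v w \<longleftrightarrow> v_structure H u v w" for u v w
    using v_structure_recovered[OF G H B0 B(1), where i = u and k = v and j = w]
      v_structure_recovered[OF H G B0 B(1), where i = u and k = v and j = w] eq adj by blast
  ultimately show "same_structure G H" by (simp add: same_structure_def)
next
  assume same: "same_structure G H"
  have "connected_within H K B i j" if "connected_within G K B i j" for i j K
    by (rule connected_within_transfer[OF same G(2) H(2) B(2) that])
  moreover have "connected_within G K B i j" if "connected_within H K B i j" for i j K
    by (rule connected_within_transfer[OF same_structure_sym[OF same] H(2) G(2) B(2) that])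
  ultimately show ?eq by blast
qed

section \<open>The two separation criteria\<close>

text \<open>
  \<open>collider_at\<close> for a walk whose first vertex may have been entered through an arrowhead.
\<close>

definition collider_from :: "(nat \<times> nat) set \<Rightarrow> bool \<Rightarrow> nat list \<Rightarrow> nat \<Rightarrow> bool" where
  "collider_from E s p l \<longleftrightarrow>
     (if l = 0 then s \<and> Suc 0 < length p \<and> (p ! 1, p ! 0) \<in> E else collider_at E p l)"

lemma collider_from_False: "collider_from E False p l \<longleftrightarrow> collider_at E p l"
  by (simp add: collider_from_def collider_at_def)

lemma collider_from_Suc:
  "collider_from E s (v # w # q) (Suc l) \<longleftrightarrow> collider_from E ((v, w) \<in> E) (w # q) l"
  by (cases l) (auto simp: collider_from_def collider_at_def)

lemma card_colliders:
  "finite {l. collider_from E s (v # q) l} \<and>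
   card {l. collider_from E s (v # q) l} = colliders E s v q"
proof (induction q arbitrary: s v)
  case Nil
  then show ?case by (simp add: collider_from_def collider_at_def)
next
  case (Cons w q)
  let ?C = "{l. collider_from E ((v, w) \<in> E) (w # q) l}"
  \<comment> \<open>Position 0 is decided by the flag; the other positions are those of the tail,
    shifted by one.\<close>
  have "{l. collider_from E s (v # w # q) l} =
    (if s \<and> (w, v) \<in> E then {0} else {}) \<union> Suc ` ?C" (is "?L = ?R")
  proof (rule set_eqI)
    fix l show "l \<in> ?L \<longleftrightarrow> l \<in> ?R"
      by (cases l) (auto simp: collider_from_Suc, auto simp: collider_from_def)
  qed
  then show ?case using Cons[of "(v, w) \<in> E" w] by (auto simp: card_image card_insert_if)
qed

text \<open>One-vertex directed paths match the reflexive part of \<open>anc\<close>; longer ones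
  stay in \<open>{1..n}\<close> because the edges do.\<close>

lemma anc_ancestors:
  assumes "E \<subseteq> {1..n} \<times> {1..n}" "K \<subseteq> {1..n}"
  shows "K \<union> ancestors n E K = anc E K"
proof -
  have "(hd p, last p) \<in> E\<^sup>*" if "\<forall>l. Suc l < length p \<longrightarrow> (p ! l, p ! Suc l) \<in> E" "p \<noteq> []" for p
    using that
  proof (induction p rule: induct_list012)
    case (3 x y zs)
    have "(hd (y # zs), last (y # zs)) \<in> E\<^sup>*" using 3(2) 3(3) by fastforce
    moreover have "(x, y) \<in> E" using 3(3) by fastforce
    ultimately show ?case by (simp add: converse_rtrancl_into_rtrancl)
  qed auto
  then have "ancestors n E K \<subseteq> anc E K"
    by (fastforce simp: ancestors_def anc_def directed_path_def path_between_def graph_path_def)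
  moreover have "\<exists>p. directed_path n E v k p" if "(v, k) \<in> E\<^sup>*" "k \<in> K" for v k
    using that
  proof (induction rule: converse_rtrancl_induct)
    case base
    then show ?case using assms(2)
      by (intro exI[of _ "[k]"]) (auto simp: directed_path_def path_between_def graph_path_def)
  next
    case (step v w)
    then obtain p where p: "directed_path n E w k p" by blast
    then obtain r where r: "p = w # r"
      by (cases p) (auto simp: directed_path_def path_between_def graph_path_def)
    have "directed_path n E v k (v # p)" using p step(1) assms(1) unfolding r
      by (auto simp: directed_path_def path_between_def graph_path_def nth_Cons split: nat.splits)
    then show ?case ..
  qed
  then have "anc E K \<subseteq> ancestors n E K"
    unfolding anc_def ancestors_def by (intro subsetI) (elim CollectE bexE, intro CollectI bexI)
  ultimately show ?thesis using anc_base[of _ K E] by auto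
qed

text \<open>Turns the recursion into conditions on positions, the form in which
  \<open>d_connecting\<close> is stated.\<close>

lemma open_walk_iff:
  "open_walk E K s v q \<longleftrightarrow>
    (\<forall>l. Suc l < length (v # q) \<longrightarrow> adj E ((v # q) ! l) ((v # q) ! Suc l)) \<and>
    (\<forall>l < length (v # q).
       if collider_from E s (v # q) l then (v # q) ! l \<in> anc E K else (v # q) ! l \<notin> K)"
proof (induction q arbitrary: s v)
  case Nil
  then show ?case by (simp add: collider_from_def collider_at_def)
next
  case (Cons w q)
  have a: "(\<forall>l. Suc l < length (v # w # q) \<longrightarrow> adj E ((v # w # q) ! l) ((v # w # q) ! Suc l)) \<longleftrightarrow>
    adj E v w \<and> (\<forall>l. Suc l < length (w # q) \<longrightarrow> adj E ((w # q) ! l) ((w # q) ! Suc l))"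
    by (auto simp: nth_Cons split: nat.splits)
  have b: "collider_from E s (v # w # q) 0 \<longleftrightarrow> s \<and> (w, v) \<in> E" by (simp add: collider_from_def)
  let ?ok = "\<lambda>s p l. if collider_from E s p l then p ! l \<in> anc E K else p ! l \<notin> K"
  have c: "(\<forall>l < length (v # w # q). ?ok s (v # w # q) l) \<longleftrightarrow>
    (if s \<and> (w, v) \<in> E then v \<in> anc E K else v \<notin> K) \<and>
    (\<forall>l < length (w # q). ?ok ((v, w) \<in> E) (w # q) l)"
    unfolding length_Cons[of v] All_less_Suc2 collider_from_Suc nth_Cons_Suc nth_Cons_0 b
    by (rule refl)
  show ?case
    unfolding a c open_walk.simps Cons[of "(v, w) \<in> E" w] by blast
qed

lemma connecting_walk_iff:
  assumes E: "E \<subseteq> {1..n} \<times> {1..n}" and K: "K \<subseteq> {1..n}" and i: "i \<in> {1..n}"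
  shows "path_between n E i j p \<and> d_connecting n E K p \<longleftrightarrow>
    (\<exists>q. p = i # q \<and> open_walk E K False i q \<and> last (i # q) = j)"
proof -
  \<comment> \<open>Path membership in \<open>{1..n}\<close> is automatic for walks, as every vertex
    after the first is the end of an edge.\<close>
  have V: "set q \<subseteq> {1..n}" if "open_walk E K s v q" for s v q
    using that E by (induction q arbitrary: s v) auto
  have walk: "open_walk E K False i q \<longleftrightarrow> d_connecting n E K (i # q) \<and>
    (\<forall>l. Suc l < length (i # q) \<longrightarrow> adj E ((i # q) ! l) ((i # q) ! Suc l))" for q
    unfolding open_walk_iff d_connecting_def collider_from_False anc_ancestors[OF E K] if_bool_eq_conj
    by blast
  have path: "path_between n E i j (i # q) \<longleftrightarrow> set q \<subseteq> {1..n} \<and> last (i # q) = j \<and>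
    (\<forall>l. Suc l < length (i # q) \<longrightarrow> adj E ((i # q) ! l) ((i # q) ! Suc l))" for q
    using i by (auto simp only: path_between_def graph_path_def list.simps list.sel insert_subset)
  have "path_between n E i j (i # q) \<and> d_connecting n E K (i # q) \<longleftrightarrow>
    open_walk E K False i q \<and> last (i # q) = j" for q
    using walk[of q] path[of q] V[of False i q] by argo
  moreover have "\<exists>q. p = i # q" if "path_between n E i j p"
    using that by (cases p) (auto simp: path_between_def graph_path_def)
  ultimately show ?thesis by metis
qed

section \<open>Reduction of Markov equivalence to connectedness of pairs\<close>

lemma markov_equivalent_iff:
  assumes sep: "\<And>E I J K. E \<subseteq> {1..n} \<times> {1..n} \<Longrightarrow> (I, J, K) \<in> ci_triples n \<Longrightarrow>
      sep n E I J K \<longleftrightarrow> \<not> (\<exists>i\<in>I. \<exists>j\<in>J. connected_within E K B i j)"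
    and G: "dag n G" and H: "dag n H"
    and B: "B 1" "antimono B"
  shows "markov_equivalent sep n G H \<longleftrightarrow> same_structure G H"
proof -
  have EG: "G \<subseteq> {1..n} \<times> {1..n}" "acyclic G" and EH: "H \<subseteq> {1..n} \<times> {1..n}" "acyclic H"
    using G H by (auto simp: dag_def)
  have "markov_equivalent sep n G H \<longleftrightarrow> (\<forall>(I, J, K) \<in> ci_triples n. sep n G I J K = sep n H I J K)"
    unfolding markov_equivalent_def by (auto simp: set_eq_iff)
  also have "\<dots> \<longleftrightarrow> (\<forall>(I, J, K) \<in> ci_triples n.
    (\<exists>i\<in>I. \<exists>j\<in>J. connected_within G K B i j) = (\<exists>i\<in>I. \<exists>j\<in>J. connected_within H K B i j))"
    by (intro ball_cong refl) (auto simp: sep[OF EG(1)] sep[OF EH(1)])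
  also have "\<dots> \<longleftrightarrow> (\<forall>i\<in>{1..n}. \<forall>j\<in>{1..n}. \<forall>K \<subseteq> {1..n} - {i, j}. i \<noteq> j \<longrightarrow>
      connected_within G K B i j = connected_within H K B i j)" (is "?L \<longleftrightarrow> ?R")
  proof
    assume L: ?L
    show ?R
    proof (intro ballI allI impI)
      fix i j K assume "i \<in> {1..n}" "j \<in> {1..n}" "K \<subseteq> {1..n} - {i, j}" "i \<noteq> j"
      \<comment> \<open>Singletons isolate the statement about one pair.\<close>
      then have "({i}, {j}, K) \<in> ci_triples n" by (auto simp: ci_triples_def)
      with L show "connected_within G K B i j = connected_within H K B i j" by fastforce
    qed
  next
    assume R: ?R
    have "connected_within G K B i j = connected_within H K B i j"
      if "(I, J, K) \<in> ci_triples n" "i \<in> I" "j \<in> J" for I J K i j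
    proof -
      have "i \<in> {1..n}" "j \<in> {1..n}" "K \<subseteq> {1..n} - {i, j}" "i \<noteq> j"
        using that by (auto simp: ci_triples_def)
      with R show ?thesis by blast
    qed
    then show ?L by blast
  qed
  also have "\<dots> \<longleftrightarrow> same_structure G H"
    by (rule connected_within_iff_same_structure[OF EG EH B])
  finally show ?thesis .
qed

lemma ci_triplesD:
  "(I, J, K) \<in> ci_triples n \<Longrightarrow> K \<subseteq> {1..n}" "(I, J, K) \<in> ci_triples n \<Longrightarrow> i \<in> I \<Longrightarrow> i \<in> {1..n}"
  by (auto simp: ci_triples_def)

lemma d_sep_iff:
  assumes "E \<subseteq> {1..n} \<times> {1..n}" "(I, J, K) \<in> ci_triples n"
  shows "d_sep n E I J K \<longleftrightarrow> \<not> (\<exists>i\<in>I. \<exists>j\<in>J. connected_within E K (\<lambda>_. True) i j)"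
proof -
  have "d_connected n E K i j \<longleftrightarrow> connected_within E K (\<lambda>_. True) i j" if "i \<in> I" for i j
    using connecting_walk_iff[OF assms(1) ci_triplesD(1)[OF assms(2)] ci_triplesD(2)[OF assms(2) that]]
    by (auto simp: d_connected_def connected_within_def)
  then show ?thesis by (auto simp: d_sep_def)
qed

lemma star_sep_iff:
  assumes "E \<subseteq> {1..n} \<times> {1..n}" "(I, J, K) \<in> ci_triples n"
  shows "star_sep n E I J K \<longleftrightarrow> \<not> (\<exists>i\<in>I. \<exists>j\<in>J. connected_within E K (\<lambda>c. c \<le> 1) i j)"
proof -
  have card: "card {l. collider_at E (i # q) l} = colliders E False i q" for i q
    using card_colliders[of E False i q] by (simp add: collider_from_False)
  have "star_connected n E K i j \<longleftrightarrow> connected_within E K (\<lambda>c. c \<le> 1) i j" if "i \<in> I" for i j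
  proof -
    have "star_connected n E K i j \<longleftrightarrow>
      (\<exists>p. (path_between n E i j p \<and> d_connecting n E K p) \<and> card {l. collider_at E p l} \<le> 1)"
      by (auto simp: star_connected_def star_connecting_def)
    also have "\<dots> \<longleftrightarrow> connected_within E K (\<lambda>c. c \<le> 1) i j"
      unfolding connected_within_def card[symmetric]
        connecting_walk_iff[OF assms(1) ci_triplesD(1)[OF assms(2)] ci_triplesD(2)[OF assms(2) that]]
      by blast
    finally show ?thesis .
  qed
  then show ?thesis by (auto simp: star_sep_def)
qed

theorem theorem3p4:
  fixes n :: nat and G H :: "(nat \<times> nat) set"
  assumes "n \<ge> 1"
    and "dag n G"
    and "dag n H"
  shows "markov_equivalent d_sep n G H \<longleftrightarrow> markov_equivalent star_sep n G H"
proof -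
  have "markov_equivalent d_sep n G H \<longleftrightarrow> same_structure G H"
    by (rule markov_equivalent_iff[OF d_sep_iff assms(2,3)]) (auto simp: monotone_def)
  moreover have "markov_equivalent star_sep n G H \<longleftrightarrow> same_structure G H"
    by (rule markov_equivalent_iff[OF star_sep_iff assms(2,3)]) (auto simp: monotone_def)
  ultimately show ?thesis by simp
qed

end
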